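(* Let $\mathcal{F}=(\blacksquare;w_1,\dots,w_N)$ be the bilinear iterated function system described in the context and let $\Gamma(f)$ denote its attractor, the graph of the bilinear fractal interpolant $f$. Suppose that the knots are uniformly spaced on $I=[0,1]$, i.e. $X_j=j/N$ for all $j=0,1,\dots,N$, and suppose that $s_0=s_N$. Let $$\gamma=\sum_{n=1}^{N}\frac{s_{n-1}+s_n}{2}.$$ If $\gamma>1$ and $\Gamma(f)$ is not a straight line segment, then $$\dim_B\Gamma(f)=1+\frac{\log\gamma}{\log N};$$ otherwise $\dim_B\Gamma(f)=1$.
   Context: Let $N>1$ be an integer, $I=[0,1]$ and $\blacksquare=I\times I$. Let $0=X_0<X_1<\cdots<X_N=1$, and let $\underline{Y}_j,\overline{Y}_j\in I$, $j=0,1,\dots,N$, satisfy $0\le\underline{Y}_j\le\overline{Y}_j<1$ for all $j$, and $\underline{Y}_0=\underline{Y}_N=0$. Put $s_j=\overline{Y}_j-\underline{Y}_j$ (so $0\le s_j<1$), $j=0,\dots,N$, and $a_n=\underline{Y}_n-\underline{Y}_{n-1}$, $n=1,\dots,N$. For $n=1,\dots,N$ let $l_n:I\to[X_{n-1},X_n]$, $l_n(x)=X_{n-1}+(X_n-X_{n-1})x$, and $$B_n(x,y)=a_nx+[s_{n-1}+(s_n-s_{n-1})x]\,y+\underline{Y}_{n-1},$$ and set $w_n(x,y)=(l_n(x),B_n(x,y))$, a map $\blacksquare\to\blacksquare$. The family $\mathcal{F}=(\blacksquare;w_1,\dots,w_N)$ is called a bilinear IFS. Its attractor is the unique nonempty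 compact set $A\subset\blacksquare$ with $A=\bigcup_{n=1}^N w_n(A)$; it is the graph $\Gamma(f)=\{(x,f(x)):x\in I\}$ of the bilinear fractal interpolant $f$, i.e. the unique continuous function $f:I\to\mathbb{R}$ with $f(X_j)=\underline{Y}_j$ for $j=0,\dots,N$ and $f(l_n(x))=B_n(x,f(x))$ for all $x\in I$, $n=1,\dots,N$. The box dimension of a bounded set $M\subset\mathbb{R}^2$ is $$\dim_B M=\lim_{\varepsilon\to0+}\frac{\log\mathcal{N}_\varepsilon(M)}{\log\varepsilon^{-1}},$$ where $\mathcal{N}_\varepsilon(M)$ is the minimum number of square boxes of side $\varepsilon$, with sides parallel to the axes, whose union contains $M$. The statement $\dim_B M=D$ means that this limit exists and equals $D$. *)

theory Defs
  imports "HOL-Analysis.Analysis"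
begin

text \<open>
  Only the values of \<open>X\<close>, \<open>Ylo\<close>, \<open>Yhi\<close> at the indices \<open>0, \<dots>, N\<close> are relevant;
  \<open>Ylo j\<close> and \<open>Yhi j\<close> stand for \<open>Y\<^sub>j\<close> with a bar below and a bar above, respectively.
\<close>

locale bilinear_ifs =
  fixes N :: nat
    and X Ylo Yhi :: "nat \<Rightarrow> real"
  assumes N_gt_1: "N > 1"
    and X_0: "X 0 = 0"
    and X_N: "X N = 1"
    and X_less: "\<And>n. n \<in> {1..N} \<Longrightarrow> X (n - 1) < X n"
    and Ylo_nonneg: "\<And>j. j \<le> N \<Longrightarrow> 0 \<le> Ylo j"
    and Ylo_le_Yhi: "\<And>j. j \<le> N \<Longrightarrow> Ylo j \<le> Yhi j"
    and Yhi_less_1: "\<And>j. j \<le> N \<Longrightarrow> Yhi j < 1"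
    and Ylo_0: "Ylo 0 = 0"
    and Ylo_N: "Ylo N = 0"
begin

definition scaling :: "nat \<Rightarrow> real" where
  "scaling j = Yhi j - Ylo j"

definition l :: "nat \<Rightarrow> real \<Rightarrow> real" where
  "l n x = X (n - 1) + (X n - X (n - 1)) * x"

definition B :: "nat \<Rightarrow> real \<Rightarrow> real \<Rightarrow> real" where
  "B n x y = (Ylo n - Ylo (n - 1)) * x
     + (scaling (n - 1) + (scaling n - scaling (n - 1)) * x) * y + Ylo (n - 1)"

definition w :: "nat \<Rightarrow> real \<times> real \<Rightarrow> real \<times> real" where
  "w n = (\<lambda>(x, y). (l n x, B n x y))"

definition is_attractor :: "(real \<times> real) set \<Rightarrow> bool" where
  "is_attractor A \<longleftrightarrow>
     A \<noteq> {} \<and> compact A \<and> A \<subseteq> {0..1} \<times> {0..1} \<and> A = (\<Union>n\<in>{1..N}. w n ` A)"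

text \<open>The values of \<open>f\<close> outside the unit interval are left unconstrained.\<close>

definition is_interpolant :: "(real \<Rightarrow> real) \<Rightarrow> bool" where
  "is_interpolant f \<longleftrightarrow>
     continuous_on {0..1} f \<and>
     (\<forall>j\<le>N. f (X j) = Ylo j) \<and>
     (\<forall>n\<in>{1..N}. \<forall>x\<in>{0..1}. f (l n x) = B n x (f x))"

end

definition unit_graph :: "(real \<Rightarrow> real) \<Rightarrow> (real \<times> real) set" where
  "unit_graph f = (\<lambda>x. (x, f x)) ` {0..1}"

definition is_line_segment :: "(real \<times> real) set \<Rightarrow> bool" where
  "is_line_segment S \<longleftrightarrow> (\<exists>a b. a \<noteq> b \<and> S = closed_segment a b)"

text \<open>Boxes are closed and are represented by their lower left corners.\<close>

definition square_box :: "real \<Rightarrow> real \<times> real \<Rightarrow> (real \<times> real) set" where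
  "square_box \<epsilon> p = {fst p..fst p + \<epsilon>} \<times> {snd p..snd p + \<epsilon>}"

text \<open>Meaningful only for bounded sets and positive side lengths.\<close>

definition box_count :: "real \<Rightarrow> (real \<times> real) set \<Rightarrow> nat" where
  "box_count \<epsilon> M = (LEAST k. \<exists>C. finite C \<and> card C = k \<and> M \<subseteq> (\<Union>p\<in>C. square_box \<epsilon> p))"

definition has_box_dimension :: "(real \<times> real) set \<Rightarrow> real \<Rightarrow> bool" where
  "has_box_dimension M D \<longleftrightarrow>
     bounded M \<and> ((\<lambda>\<epsilon>. ln (real (box_count \<epsilon> M)) / ln (1 / \<epsilon>)) \<longlongrightarrow> D) (at_right 0)"

end

theory Submission
  imports Defs "HOL-Real_Asymp.Real_Asymp"
begin

text \<open>
  On equally spaced knots the interpolant satisfies, for \<open>m < N\<close> and \<open>x \<in> [0, 1]\<close>,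
  \<open>f ((m + x) / N) = a\<^sub>m x + S\<^sub>m(x) f(x) + c\<^sub>m\<close>, where \<open>S\<^sub>m\<close> interpolates
  linearly between \<open>s\<^sub>m\<close> and \<open>s\<^sub>m\<^sub>+\<^sub>1\<close>. Because \<open>s\<^sub>0 = s\<^sub>N\<close>, the slopes of
  the \<open>S\<^sub>m\<close> cancel and \<open>\<Sum>\<^sub>m S\<^sub>m(x) = \<gamma>\<close> for \<^emph>\<open>every\<close> \<open>x\<close> (lemma \<open>sum_S\<close>); the
  \<open>a\<^sub>m\<close> sum to zero as well, because \<open>f\<close> vanishes at both ends. This constancy is what
  makes the dimension computable.

  Cut \<open>[0, 1]\<close> into the \<open>N\<^sup>k\<close> cells of length \<open>N\<^sup>-\<^sup>k\<close> and let \<open>O\<^sub>k\<close> be the sum of the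
  oscillations of \<open>f\<close> on them. A box of side about \<open>N\<^sup>-\<^sup>k\<close> meets boundedly many cells, and the
  part of the graph above a cell needs about as many boxes as its oscillation contains box sides,
  plus one. Hence \<open>O\<^sub>k\<close> growing like \<open>g\<^sup>k\<close> with \<open>g \<ge> 1\<close>, up to a factor polynomial in \<open>k\<close>,
  gives box dimension \<open>1 + ln g / ln N\<close> (lemma \<open>box_dimension_of_oscillation\<close>).

  For the lower bound no individual oscillation has to be controlled. Summing the functional
  equation over \<open>m\<close> gives \<open>\<Sum>\<^sub>m f ((m + x) / N) = const + \<gamma> f(x)\<close>, and by iteration
  \<open>\<Sum>\<^sub>j f ((j + x) / N\<^sup>k) = const\<^sub>k + \<gamma>\<^sup>k f(x)\<close>, the sum extending over all cells. Comparing the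
  points \<open>x\<close> and \<open>0\<close> yields \<open>O\<^sub>k \<ge> \<gamma>\<^sup>k \<bar>f(x)\<bar>\<close> (lemma \<open>total_oscillation_ge\<close>). As the graph
  passes through \<open>(0, 0)\<close> and \<open>(1, 0)\<close>, it is a segment only if \<open>f = 0\<close>; otherwise
  some \<open>f(x) \<noteq> 0\<close>, and the bound is effective.

  For the upper bound, \<open>S\<^sub>m\<close> varies by \<open>O(N\<^sup>-\<^sup>k)\<close> on a cell, so the functional equation gives
  \<open>O\<^sub>k\<^sub>+\<^sub>1 \<le> (\<gamma> + C N\<^sup>-\<^sup>k) O\<^sub>k + C'\<close>. The perturbations \<open>C N\<^sup>-\<^sup>k\<close> are summable, hence
  \<open>O\<^sub>k \<le> D (k + 1) max(1, \<gamma>)\<^sup>k\<close> (lemma \<open>total_oscillation_le\<close>).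

  The attractor is the graph because each map of the system contracts the vertical distance to the
  graph by a factor bounded away from 1, and because the maps \<open>x \<mapsto> (m + x) / N\<close> leave no closed
  nonempty subset of \<open>[0, 1]\<close> invariant other than the whole interval.
\<close>

section \<open>Box counts\<close>

lemma box_count_le_card:
  assumes "finite C" "M \<subseteq> (\<Union>p\<in>C. square_box \<epsilon> p)"
  shows "box_count \<epsilon> M \<le> card C"
  unfolding box_count_def using assms by (intro Least_le) blast

lemma box_count_attained:
  assumes "finite C0" "M \<subseteq> (\<Union>p\<in>C0. square_box \<epsilon> p)"
  obtains C where "finite C" "card C = box_count \<epsilon> M" "M \<subseteq> (\<Union>p\<in>C. square_box \<epsilon> p)"
proof -
  let ?P = "\<lambda>k. \<exists>C. finite C \<and> card C = k \<and> M \<subseteq> (\<Union>p\<in>C. square_box \<epsilon> p)"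
  have "?P (card C0)"
    using assms by blast
  from LeastI[of ?P, OF this] show ?thesis
    using that unfolding box_count_def by blast
qed

text \<open>
  Every lower bound on a box count below goes through this comparison of lengths, applied to the
  horizontal or vertical projections of boxes.
\<close>

lemma interval_length_le_card_cover:
  fixes a b \<epsilon> :: real
  assumes "finite C" "{a..b} \<subseteq> (\<Union>p\<in>C. {g p..g p + \<epsilon>})" "\<epsilon> > 0"
  shows "b - a \<le> real (card C) * \<epsilon>"
proof (cases "a \<le> b")
  case True
  have "b - a = measure lborel {a..b}"
    using True by simp
  also have "\<dots> \<le> measure lborel (\<Union>p\<in>C. {g p..g p + \<epsilon>})"
  proof (rule measure_mono_fmeasurable)
    show "(\<Union>p\<in>C. {g p..g p + \<epsilon>}) \<in> fmeasurable lborel"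
      using assms(1) by (intro fmeasurable.finite_UN) (auto simp: fmeasurable_compact)
  qed (use assms in auto)
  also have "\<dots> \<le> (\<Sum>p\<in>C. measure lborel {g p..g p + \<epsilon>})"
    using assms(1) by (intro measure_UNION_le) auto
  also have "\<dots> = real (card C) * \<epsilon>"
    using assms(3) by simp
  finally show ?thesis .
next
  case False
  then show ?thesis
    using assms(3) by (smt (verit) mult_nonneg_nonneg of_nat_0_le_iff)
qed

definition cell :: "nat \<Rightarrow> nat \<Rightarrow> nat \<Rightarrow> real set" where
  "cell N k j = {real j / real N ^ k..(real j + 1) / real N ^ k}"

lemma cell_subset_unit:
  assumes "N > 0" "j < N ^ k"
  shows "cell N k j \<subseteq> {0..1}"
proof -
  have "real j + 1 \<le> real (N ^ k)"
    using assms(2) by linarith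
  then show ?thesis
    using assms(1) by (auto simp: cell_def field_simps intro: order_trans[of _ "real j + 1"])
qed

lemma in_some_cell:
  assumes "N > 0" "x \<in> {0..1}"
  shows "\<exists>j<N ^ k. x \<in> cell N k j"
proof (cases "x = 1")
  case True
  have "real (N ^ k - 1) + 1 = real N ^ k"
    using assms(1) by (simp add: of_nat_diff)
  then have "x \<in> cell N k (N ^ k - 1)"
    using True assms(1) by (simp add: cell_def)
  then show ?thesis
    using assms(1) by (intro exI[of _ "N ^ k - 1"]) auto
next
  case False
  define j where "j = nat \<lfloor>x * real N ^ k\<rfloor>"
  have M: "real N ^ k > 0"
    using assms(1) by simp
  have j: "real j \<le> x * real N ^ k" "x * real N ^ k < real j + 1"
  proof -
    have "0 \<le> x * real N ^ k"
      using assms(2) M by simp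
    then show "real j \<le> x * real N ^ k" "x * real N ^ k < real j + 1"
      unfolding j_def by linarith+
  qed
  have "x * real N ^ k < 1 * real N ^ k"
    using False assms(2) M by (intro mult_strict_right_mono) auto
  then have "real j < real N ^ k"
    using j(1) by linarith
  then have "j < N ^ k"
    by (simp flip: of_nat_power)
  then show ?thesis
    using j M by (intro exI[of _ j]) (auto simp: cell_def field_simps)
qed

text \<open>
  If the cells are at most as wide as the boxes, one column of boxes per cell suffices. Its height
  is \<open>2 \<omega>\<close> instead of \<open>\<omega>\<close> because the column is centred at the value of \<open>f\<close> at the left end of
  the cell, which need not be an extreme value.
\<close>

lemma box_cover_of_oscillation:
  assumes N: "N > 0" and e: "\<epsilon> > 0" "1 / real N ^ k \<le> \<epsilon>"
    and \<omega>: "\<And>j u v. j < N ^ k \<Longrightarrow> u \<in> cell N k j \<Longrightarrow> v \<in> cell N k j \<Longrightarrow> \<bar>f u - f v\<bar> \<le> \<omega> j"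
  shows "\<exists>C. finite C \<and> unit_graph f \<subseteq> (\<Union>p\<in>C. square_box \<epsilon> p) \<and>
    real (card C) \<le> 2 * (\<Sum>j<N ^ k. \<omega> j) / \<epsilon> + real N ^ k"
proof -
  define c where "c j = real j / real N ^ k" for j
  define D where "D j = (\<lambda>i. (c j, f (c j) - \<omega> j + real i * \<epsilon>)) ` {..nat \<lfloor>2 * \<omega> j / \<epsilon>\<rfloor>}" for j
  define C where "C = (\<Union>j<N ^ k. D j)"
  have c_cell: "c j \<in> cell N k j" for j
    using N by (auto simp: c_def cell_def divide_simps)
  have \<omega>_nonneg: "\<omega> j \<ge> 0" if "j < N ^ k" for j
    using \<omega>[OF that c_cell c_cell] by simp
  have "finite C"
    by (auto simp: C_def D_def)
  moreover have "unit_graph f \<subseteq> (\<Union>p\<in>C. square_box \<epsilon> p)"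
  proof
    fix p assume "p \<in> unit_graph f"
    then obtain x where x: "x \<in> {0..1}" "p = (x, f x)"
      by (auto simp: unit_graph_def)
    obtain j where j: "j < N ^ k" "x \<in> cell N k j"
      using in_some_cell[OF N x(1)] by blast
    have xc: "c j \<le> x" "x \<le> c j + \<epsilon>"
      using j(2) e(2) by (auto simp: cell_def c_def add_divide_distrib)
    define h where "h = f x - (f (c j) - \<omega> j)"
    have h: "0 \<le> h" "h \<le> 2 * \<omega> j"
      using \<omega>[OF j c_cell] unfolding h_def by linarith+
    define i where "i = nat \<lfloor>h / \<epsilon>\<rfloor>"
    have "0 \<le> h / \<epsilon>"
      using h(1) e(1) by simp
    then have "real i \<le> h / \<epsilon>" "h / \<epsilon> \<le> real i + 1"
      unfolding i_def by linarith+
    then have i: "real i * \<epsilon> \<le> h" "h \<le> real i * \<epsilon> + \<epsilon>"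
      using e(1) by (auto simp: field_simps)
    have "i \<le> nat \<lfloor>2 * \<omega> j / \<epsilon>\<rfloor>"
      unfolding i_def using h e(1) by (intro nat_mono floor_mono divide_right_mono) auto
    then have "(c j, f (c j) - \<omega> j + real i * \<epsilon>) \<in> C"
      using j(1) by (auto simp: C_def D_def)
    moreover have "p \<in> square_box \<epsilon> (c j, f (c j) - \<omega> j + real i * \<epsilon>)"
      using xc i x(2) by (auto simp: square_box_def h_def)
    ultimately show "p \<in> (\<Union>p\<in>C. square_box \<epsilon> p)"
      by blast
  qed
  moreover have "real (card C) \<le> 2 * (\<Sum>j<N ^ k. \<omega> j) / \<epsilon> + real N ^ k"
  proof -
    have D: "real (card (D j)) \<le> 2 * \<omega> j / \<epsilon> + 1" if "j < N ^ k" for j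
    proof -
      have "card (D j) \<le> nat \<lfloor>2 * \<omega> j / \<epsilon>\<rfloor> + 1"
        unfolding D_def by (rule order_trans[OF card_image_le]) auto
      moreover have "real (nat \<lfloor>2 * \<omega> j / \<epsilon>\<rfloor>) \<le> 2 * \<omega> j / \<epsilon>"
        using \<omega>_nonneg[OF that] e(1) by simp
      ultimately show ?thesis by linarith
    qed
    have "card C \<le> (\<Sum>j<N ^ k. card (D j))"
      unfolding C_def by (intro card_UN_le) auto
    then have "real (card C) \<le> (\<Sum>j<N ^ k. real (card (D j)))"
      by (metis of_nat_mono of_nat_sum)
    also have "\<dots> \<le> (\<Sum>j<N ^ k. 2 * \<omega> j / \<epsilon> + 1)"
      using D by (intro sum_mono) auto
    also have "\<dots> = 2 * (\<Sum>j<N ^ k. \<omega> j) / \<epsilon> + real N ^ k"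
      by (simp add: sum.distrib sum_distrib_left sum_divide_distrib)
    finally show ?thesis .
  qed
  ultimately show ?thesis by blast
qed

text \<open>
  Three rather than two, because the cells are closed: an interval that coincides with a cell also
  touches both neighbours of that cell.
\<close>

lemma card_cells_met_le:
  assumes N: "N > 0" and e: "\<epsilon> \<le> 1 / real N ^ k"
  shows "card {j\<in>{..<N ^ k}. {a..a + \<epsilon>} \<inter> cell N k j \<noteq> {}} \<le> 3"
proof -
  define M where "M = real N ^ k"
  define z where "z = \<lceil>a * M - 1\<rceil>"
  have M: "M > 0" "\<epsilon> * M \<le> 1"
    using N e by (auto simp: M_def field_simps)
  have "{j\<in>{..<N ^ k}. {a..a + \<epsilon>} \<inter> cell N k j \<noteq> {}} \<subseteq> nat ` {z..z + 2}"
  proof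
    fix j assume "j \<in> {j\<in>{..<N ^ k}. {a..a + \<epsilon>} \<inter> cell N k j \<noteq> {}}"
    then obtain x where "x \<in> {a..a + \<epsilon>}" "x \<in> cell N k j"
      by blast
    then have "real j / M \<le> a + \<epsilon>" "a \<le> (real j + 1) / M"
      by (auto simp: cell_def M_def)
    then have "real j \<le> a * M + \<epsilon> * M" "a * M \<le> real j + 1"
      using M(1) by (auto simp: field_simps)
    then have "real j \<le> a * M + 1" "a * M - 1 \<le> real j"
      using M(2) by linarith+
    then have "int j \<in> {z..z + 2}"
      unfolding z_def by simp linarith
    then show "j \<in> nat ` {z..z + 2}"
      by (metis image_eqI nat_int)
  qed
  then have "card {j\<in>{..<N ^ k}. {a..a + \<epsilon>} \<inter> cell N k j \<noteq> {}} \<le> card (nat ` {z..z + 2})"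
    by (intro card_mono) auto
  also have "\<dots> \<le> card {z..z + 2}"
    by (intro card_image_le) auto
  finally show ?thesis by simp
qed

text \<open>
  By the intermediate value theorem the boxes that meet the strip above a cell cover all heights
  between \<open>f(u)\<close> and \<open>f(v)\<close>, so their number bounds the oscillation. Summed over the cells, each
  box is counted at most three times.
\<close>

lemma oscillation_le_card_cover:
  assumes N: "N > 0" and e: "\<epsilon> > 0" "\<epsilon> \<le> 1 / real N ^ k"
    and f: "continuous_on {0..1} f"
    and C: "finite C" "unit_graph f \<subseteq> (\<Union>p\<in>C. square_box \<epsilon> p)"
    and uv: "\<And>j. j < N ^ k \<Longrightarrow> u j \<in> cell N k j" "\<And>j. j < N ^ k \<Longrightarrow> v j \<in> cell N k j"
  shows "(\<Sum>j<N ^ k. \<bar>f (u j) - f (v j)\<bar>) \<le> 3 * real (card C) * \<epsilon>"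
proof -
  define meets where "meets p j \<longleftrightarrow> {fst p..fst p + \<epsilon>} \<inter> cell N k j \<noteq> {}" for p :: "real \<times> real" and j
  have osc: "\<bar>f (u j) - f (v j)\<bar> \<le> real (card {p\<in>C. meets p j}) * \<epsilon>" if j: "j < N ^ k" for j
  proof -
    have cell: "cell N k j \<subseteq> {0..1}"
      using cell_subset_unit[OF N j] .
    have "connected (f ` cell N k j)"
      using continuous_on_subset[OF f cell]
      by (intro connected_continuous_image) (auto simp: cell_def)
    then have "{min (f (u j)) (f (v j))..max (f (u j)) (f (v j))} \<subseteq> f ` cell N k j"
      using uv[OF j] by (intro connected_contains_Icc) (auto simp: min_def max_def)
    also have "\<dots> \<subseteq> (\<Union>p\<in>{p\<in>C. meets p j}. {snd p..snd p + \<epsilon>})"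
    proof clarify
      fix x assume x: "x \<in> cell N k j"
      then have "(x, f x) \<in> unit_graph f"
        using cell by (auto simp: unit_graph_def)
      then obtain p where "p \<in> C" "(x, f x) \<in> square_box \<epsilon> p"
        using C(2) by blast
      moreover have "meets p j"
        using x calculation unfolding meets_def square_box_def by auto
      ultimately show "f x \<in> (\<Union>p\<in>{p\<in>C. meets p j}. {snd p..snd p + \<epsilon>})"
        by (intro UN_I[of p]) (auto simp: square_box_def)
    qed
    finally show ?thesis
      using interval_length_le_card_cover[of "{p\<in>C. meets p j}" "min (f (u j)) (f (v j))" "max (f (u j)) (f (v j))" snd \<epsilon>] C(1) e(1)
      by (simp add: max_def min_def abs_if split: if_splits)
  qed
  have "(\<Sum>j<N ^ k. \<bar>f (u j) - f (v j)\<bar>) \<le> (\<Sum>j<N ^ k. real (card {p\<in>C. meets p j}) * \<epsilon>)"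
    using osc by (intro sum_mono) auto
  also have "\<dots> = real (\<Sum>j<N ^ k. card {p\<in>C. meets p j}) * \<epsilon>"
    by (simp add: sum_distrib_right)
  also have "(\<Sum>j<N ^ k. card {p\<in>C. meets p j}) = (\<Sum>p\<in>C. card {j\<in>{..<N ^ k}. meets p j})"
    using sum.swap_restrict[OF C(1) finite_lessThan[of "N ^ k"], of "\<lambda>_ _. 1::nat" meets] by simp
  also have "real \<dots> * \<epsilon> \<le> 3 * real (card C) * \<epsilon>"
  proof -
    have "(\<Sum>p\<in>C. card {j\<in>{..<N ^ k}. meets p j}) \<le> (\<Sum>p\<in>C. 3)"
      unfolding meets_def using card_cells_met_le[OF N e(2)] by (intro sum_mono) auto
    then have "(\<Sum>p\<in>C. card {j\<in>{..<N ^ k}. meets p j}) \<le> 3 * card C"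
      by simp
    then have "real (\<Sum>p\<in>C. card {j\<in>{..<N ^ k}. meets p j}) \<le> 3 * real (card C)"
      by linarith
    then show ?thesis
      using e(1) by (intro mult_right_mono) auto
  qed
  finally show ?thesis .
qed

text \<open>The graph projects onto the unit interval, which forces dimension at least 1.\<close>

lemma card_cover_ge_inverse:
  assumes "\<epsilon> > 0" "finite C" "unit_graph f \<subseteq> (\<Union>p\<in>C. square_box \<epsilon> p)"
  shows "1 / \<epsilon> \<le> real (card C)"
proof -
  have "{0..1} \<subseteq> (\<Union>p\<in>C. {fst p..fst p + \<epsilon>})"
  proof
    fix x :: real assume "x \<in> {0..1}"
    then have "(x, f x) \<in> (\<Union>p\<in>C. square_box \<epsilon> p)"
      by (intro subsetD[OF assms(3)]) (simp add: unit_graph_def)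
    then show "x \<in> (\<Union>p\<in>C. {fst p..fst p + \<epsilon>})"
      by (auto simp: square_box_def)
  qed
  from interval_length_le_card_cover[OF assms(2) this assms(1)] show ?thesis
    using assms(1) by (simp add: field_simps)
qed

section \<open>Box dimension from total oscillations\<close>

text \<open>
  Box sides vary continuously whereas cells come in discrete sizes. Passing to the nearest
  level costs a bounded factor, which the logarithmic quotient does not see.
\<close>

lemma scale_level:
  assumes "N > 1" "0 < \<epsilon>" "\<epsilon> < (1::real)"
  defines "t \<equiv> ln (1 / \<epsilon>) / ln (real N)"
  obtains k where "real k \<le> t" "t \<le> real k + 1" "real N ^ k \<le> 1 / \<epsilon>" "1 / \<epsilon> \<le> real N ^ (k + 1)"
proof
  define k where "k = nat \<lfloor>t\<rfloor>"
  have t: "t > 0" "real N powr t = 1 / \<epsilon>"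
    using assms by (auto simp: t_def powr_def)
  show k: "real k \<le> t" "t \<le> real k + 1"
    using t(1) unfolding k_def by linarith+
  have "real N ^ k = real N powr real k" "real N ^ (k + 1) = real N powr (real k + 1)"
    using assms(1) powr_realpow[of "real N" k] powr_realpow[of "real N" "k + 1"] 
    by (simp_all add: add.commute)
  then show "real N ^ k \<le> 1 / \<epsilon>" "1 / \<epsilon> \<le> real N ^ (k + 1)"
    unfolding t(2)[symmetric] using k assms(1) by (auto intro!: powr_mono)
qed

text \<open>
  Here \<open>t(\<epsilon>)\<close> is the real-valued level of \<open>\<epsilon>\<close>, so that \<open>\<epsilon> = N\<^sup>-\<^sup>t\<close>. The bounds allow for one
  level of rounding and for a polynomial factor: these change \<open>ln n(\<epsilon>)\<close> by \<open>O(ln t)\<close>, while the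
  denominator is \<open>t ln N\<close>.
\<close>

lemma box_dimension_squeeze:
  fixes n :: "real \<Rightarrow> nat" and g c D :: real
  assumes N: "N > 1" and g: "g \<ge> 1" and c: "c > 0" and D: "D \<ge> 0"
  defines "t \<equiv> \<lambda>\<epsilon>. ln (1 / \<epsilon>) / ln (real N)"
  assumes lower: "\<And>\<epsilon>. 0 < \<epsilon> \<Longrightarrow> \<epsilon> < 1 \<Longrightarrow> c * g powr (t \<epsilon> - 1) / \<epsilon> \<le> real (n \<epsilon>)"
    and upper: "\<And>\<epsilon>. 0 < \<epsilon> \<Longrightarrow> \<epsilon> < 1 \<Longrightarrow> real (n \<epsilon>) \<le> D * (t \<epsilon> + 2) * g powr (t \<epsilon> + 1) / \<epsilon>"
  shows "((\<lambda>\<epsilon>. ln (real (n \<epsilon>)) / ln (1 / \<epsilon>)) \<longlongrightarrow> 1 + ln g / ln (real N)) (at_right 0)"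
proof -
  define a b where "a = ln (real N)" and "b = ln g"
  have a: "a > 0"
    using N by (simp add: a_def)
  have ev: "eventually (\<lambda>\<epsilon>. \<epsilon> \<in> {0<..<1::real}) (at_right 0)"
    by (rule eventually_at_right_real) simp
  show ?thesis
  proof (rule tendsto_sandwich)
    let ?lo = "\<lambda>\<epsilon>::real. (ln c + (ln (1 / \<epsilon>) / a - 1) * b + ln (1 / \<epsilon>)) / ln (1 / \<epsilon>)"
    let ?hi = "\<lambda>\<epsilon>::real. (ln (D + 1) + ln (ln (1 / \<epsilon>) / a + 2) + (ln (1 / \<epsilon>) / a + 1) * b + ln (1 / \<epsilon>)) / ln (1 / \<epsilon>)"
    show "eventually (\<lambda>\<epsilon>. ?lo \<epsilon> \<le> ln (real (n \<epsilon>)) / ln (1 / \<epsilon>)) (at_right 0)"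
      using ev
    proof eventually_elim
      case (elim \<epsilon>)
      then have e: "0 < \<epsilon>" "\<epsilon> < 1" by auto
      have pos: "0 < c * g powr (t \<epsilon> - 1) / \<epsilon>"
        using c g e by simp
      have "ln c + (ln (1 / \<epsilon>) / a - 1) * b + ln (1 / \<epsilon>) = ln (c * g powr (t \<epsilon> - 1) / \<epsilon>)"
        using c g e by (simp add: ln_mult ln_div ln_powr t_def a_def b_def)
      also have "\<dots> \<le> ln (real (n \<epsilon>))"
        using lower[OF e] pos by (subst ln_le_cancel_iff) linarith+
      finally show ?case
        using e by (intro divide_right_mono) auto
    qed
    show "eventually (\<lambda>\<epsilon>. ln (real (n \<epsilon>)) / ln (1 / \<epsilon>) \<le> ?hi \<epsilon>) (at_right 0)"
      using ev
    proof eventually_elim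
      case (elim \<epsilon>)
      then have e: "0 < \<epsilon>" "\<epsilon> < 1" by auto
      have t: "t \<epsilon> > 0"
        using e N by (simp add: t_def)
      have pos: "0 < real (n \<epsilon>)"
        using lower[OF e] c g e by (smt (verit) divide_pos_pos mult_pos_pos powr_gt_zero)
      have "real (n \<epsilon>) \<le> (D + 1) * (t \<epsilon> + 2) * g powr (t \<epsilon> + 1) / \<epsilon>"
        using upper[OF e] t e
        by (elim order_trans) (auto intro!: divide_right_mono mult_right_mono)
      then have "ln (real (n \<epsilon>)) \<le> ln ((D + 1) * (t \<epsilon> + 2) * g powr (t \<epsilon> + 1) / \<epsilon>)"
        using pos by (subst ln_le_cancel_iff) linarith+
      also have "\<dots> = ln (D + 1) + ln (ln (1 / \<epsilon>) / a + 2) + (ln (1 / \<epsilon>) / a + 1) * b + ln (1 / \<epsilon>)"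
        using D g e t by (simp add: ln_mult ln_div ln_powr t_def a_def b_def)
      finally show ?case
        using e by (intro divide_right_mono) auto
    qed
    show "(?lo \<longlongrightarrow> 1 + ln g / ln (real N)) (at_right 0)"
      unfolding a_def[symmetric] b_def[symmetric] using a
      by (real_asymp simp: field_simps)
    show "(?hi \<longlongrightarrow> 1 + ln g / ln (real N)) (at_right 0)"
      unfolding a_def[symmetric] b_def[symmetric] using a
      by (real_asymp simp: field_simps)
  qed
qed

text \<open>
  The factor \<open>k + 1\<close> in the upper bound accommodates the borderline \<open>g = 1\<close>, where a recursion
  \<open>O\<^sub>k\<^sub>+\<^sub>1 \<le> O\<^sub>k + C\<close> gives linear growth only. For \<open>g = 1\<close> the lower bound
  comes from the projection to the horizontal axis, which works even if \<open>f\<close> is constant.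
\<close>

lemma box_dimension_of_oscillation:
  fixes f :: "real \<Rightarrow> real" and g c D :: real
  assumes N: "N > 1" and g: "g \<ge> 1" and c: "c > 0" and D: "D \<ge> 0"
    and f: "continuous_on {0..1} f"
    and lower: "g = 1 \<or> (\<forall>k. \<exists>u v. (\<forall>j<N ^ k. u j \<in> cell N k j \<and> v j \<in> cell N k j) \<and>
      c * g ^ k \<le> (\<Sum>j<N ^ k. \<bar>f (u j) - f (v j)\<bar>))"
    and upper: "\<And>k. \<exists>\<omega>. (\<forall>j<N ^ k. \<forall>u\<in>cell N k j. \<forall>v\<in>cell N k j. \<bar>f u - f v\<bar> \<le> \<omega> j) \<and>
      (\<Sum>j<N ^ k. \<omega> j) \<le> D * (real k + 1) * g ^ k"
  shows "has_box_dimension (unit_graph f) (1 + ln g / ln (real N))"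
proof -
  define t where "t \<epsilon> = ln (1 / \<epsilon>) / ln (real N)" for \<epsilon> :: real
  define n where "n \<epsilon> = box_count \<epsilon> (unit_graph f)" for \<epsilon>
  have cover: "\<exists>C. finite C \<and> unit_graph f \<subseteq> (\<Union>p\<in>C. square_box \<epsilon> p) \<and>
      real (card C) \<le> (2 * D + real N) * (t \<epsilon> + 2) * g powr (t \<epsilon> + 1) / \<epsilon>"
    if e: "0 < \<epsilon>" "\<epsilon> < 1" for \<epsilon>
  proof -
    obtain k where k: "real k \<le> t \<epsilon>" "real N ^ k \<le> 1 / \<epsilon>" "1 / \<epsilon> \<le> real N ^ (k + 1)"
      using scale_level[OF N e] unfolding t_def by blast
    \<comment> \<open>The finer of the two levels adjacent to \<open>\<epsilon>\<close>: covering by columns needs narrow cells.\<close>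
    define K where "K = k + 1"
    have fine: "1 / real N ^ K \<le> \<epsilon>"
      using k(3) e N unfolding K_def by (simp add: field_simps)
    obtain \<omega> where \<omega>: "\<And>j u v. j < N ^ K \<Longrightarrow> u \<in> cell N K j \<Longrightarrow> v \<in> cell N K j \<Longrightarrow> \<bar>f u - f v\<bar> \<le> \<omega> j"
        "(\<Sum>j<N ^ K. \<omega> j) \<le> D * (real K + 1) * g ^ K"
      using upper[of K] by blast
    obtain C where C: "finite C" "unit_graph f \<subseteq> (\<Union>p\<in>C. square_box \<epsilon> p)"
        "real (card C) \<le> 2 * (\<Sum>j<N ^ K. \<omega> j) / \<epsilon> + real N ^ K"
      using box_cover_of_oscillation[of N \<epsilon> K f \<omega>] N e(1) fine \<omega>(1) by auto
    define P where "P = (t \<epsilon> + 2) * g powr (t \<epsilon> + 1)"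
    have "g ^ K = g powr real K"
      using g by (simp add: powr_realpow)
    also have "\<dots> \<le> g powr (t \<epsilon> + 1)"
      using g k(1) by (intro powr_mono) (auto simp: K_def)
    finally have gK: "g ^ K \<le> g powr (t \<epsilon> + 1)" .
    have P: "(real K + 1) * g ^ K \<le> P"
      unfolding P_def using gK k(1) g by (intro mult_mono) (auto simp: K_def)
    have "1 \<le> g ^ K"
      using g by simp
    then have "1 * 1 \<le> (real K + 1) * g ^ K"
      by (intro mult_mono) auto
    then have P1: "1 \<le> P"
      using P by linarith
    have "(\<Sum>j<N ^ K. \<omega> j) \<le> D * P"
      using \<omega>(2) mult_left_mono[OF P D] by (simp add: mult.assoc)
    then have "2 * (\<Sum>j<N ^ K. \<omega> j) / \<epsilon> \<le> 2 * (D * P) / \<epsilon>"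
      using e by (intro divide_right_mono) auto
    moreover have "real N ^ K \<le> real N * P / \<epsilon>"
    proof -
      have "real N ^ K \<le> real N * (1 / \<epsilon>)"
        using mult_left_mono[OF k(2), of "real N"] by (simp add: K_def)
      also have "\<dots> \<le> real N * (P / \<epsilon>)"
        using P1 e by (intro mult_left_mono divide_right_mono) auto
      finally show ?thesis by simp
    qed
    ultimately have "real (card C) \<le> (2 * D + real N) * P / \<epsilon>"
      using C(3) by (simp add: algebra_simps add_divide_distrib)
    then show ?thesis
      using C(1,2) by (intro exI[of _ C]) (auto simp: P_def mult.assoc)
  qed
  have "((\<lambda>\<epsilon>. ln (real (n \<epsilon>)) / ln (1 / \<epsilon>)) \<longlongrightarrow> 1 + ln g / ln (real N)) (at_right 0)"
  proof (rule box_dimension_squeeze[OF N g, of "min 1 (c / 3)" "2 * D + real N"])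
    fix \<epsilon> :: real assume e: "0 < \<epsilon>" "\<epsilon> < 1"
    obtain C0 where C0: "finite C0" "unit_graph f \<subseteq> (\<Union>p\<in>C0. square_box \<epsilon> p)"
        "real (card C0) \<le> (2 * D + real N) * (t \<epsilon> + 2) * g powr (t \<epsilon> + 1) / \<epsilon>"
      using cover[OF e] by blast
    show "real (n \<epsilon>) \<le> (2 * D + real N) * (ln (1 / \<epsilon>) / ln (real N) + 2) *
        g powr (ln (1 / \<epsilon>) / ln (real N) + 1) / \<epsilon>"
      using box_count_le_card[OF C0(1,2)] C0(3) unfolding n_def t_def by linarith
    obtain C where C: "finite C" "card C = n \<epsilon>" "unit_graph f \<subseteq> (\<Union>p\<in>C. square_box \<epsilon> p)"
      using box_count_attained[OF C0(1,2)] unfolding n_def by blast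
    have "min 1 (c / 3) * g powr (t \<epsilon> - 1) / \<epsilon> \<le> real (n \<epsilon>)"
    proof (cases "g = 1")
      case True
      have "min 1 (c / 3) / \<epsilon> \<le> 1 / \<epsilon>"
        using e by (intro divide_right_mono) auto
      then show ?thesis
        using card_cover_ge_inverse[OF e(1) C(1,3)] True C(2) by simp
    next
      case False
      \<comment> \<open>The coarser of the two levels adjacent to \<open>\<epsilon>\<close>: counting meetings needs wide cells.\<close>
      obtain k where k: "t \<epsilon> \<le> real k + 1" "real N ^ k \<le> 1 / \<epsilon>"
        using scale_level[OF N e] unfolding t_def by blast
      obtain u v where uv: "\<And>j. j < N ^ k \<Longrightarrow> u j \<in> cell N k j" "\<And>j. j < N ^ k \<Longrightarrow> v j \<in> cell N k j"
          "c * g ^ k \<le> (\<Sum>j<N ^ k. \<bar>f (u j) - f (v j)\<bar>)"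
        using lower False by blast
      have "\<epsilon> \<le> 1 / real N ^ k"
        using k(2) e N by (simp add: field_simps)
      from oscillation_le_card_cover[of N, OF _ e(1) this f C(1,3) uv(1,2)]
      have "c * g ^ k \<le> 3 * real (n \<epsilon>) * \<epsilon>"
        using uv(3) N C(2) by simp
      then have le: "c / 3 * g ^ k / \<epsilon> \<le> real (n \<epsilon>)"
        using e by (simp add: field_simps)
      have "g powr (t \<epsilon> - 1) \<le> g powr real k"
        using g k(1) by (intro powr_mono) auto
      also have "\<dots> = g ^ k"
        using g by (simp add: powr_realpow)
      finally have "min 1 (c / 3) * g powr (t \<epsilon> - 1) \<le> c / 3 * g ^ k"
        using c by (intro mult_mono) auto
      then have "min 1 (c / 3) * g powr (t \<epsilon> - 1) / \<epsilon> \<le> c / 3 * g ^ k / \<epsilon>"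
        using e by (intro divide_right_mono) auto
      then show ?thesis
        using le by linarith
    qed
    then show "min 1 (c / 3) * g powr (ln (1 / \<epsilon>) / ln (real N) - 1) / \<epsilon> \<le> real (n \<epsilon>)"
      by (simp add: t_def)
  qed (use c D in auto)
  moreover have "bounded (unit_graph f)"
    unfolding unit_graph_def
    by (intro compact_imp_bounded compact_continuous_image continuous_intros f) auto
  ultimately show ?thesis
    by (simp add: has_box_dimension_def n_def)
qed

section \<open>The functional equation on equally spaced knots\<close>

text \<open>
  The leading base-\<open>N\<close> digit \<open>m\<close> of a cell number is split off, since the functional equation
  relates the subcell with digits \<open>(m, i)\<close> to the cell \<open>i\<close> one level up.
\<close>

lemma sum_digit_split:
  fixes h :: "nat \<Rightarrow> 'a::comm_monoid_add"
  shows "(\<Sum>j<N ^ Suc k. h j) = (\<Sum>i<N ^ k. \<Sum>m<N. h (m * N ^ k + i))"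
proof -
  have "(\<Sum>j<N ^ Suc k. h j) = (\<Sum>m<N. sum h {m * N ^ k..<m * N ^ k + N ^ k})"
    by (simp add: sum.nat_group)
  also have "\<dots> = (\<Sum>m<N. \<Sum>i<N ^ k. h (m * N ^ k + i))"
  proof (rule sum.cong[OF refl])
    fix m
    show "sum h {m * N ^ k..<m * N ^ k + N ^ k} = (\<Sum>i<N ^ k. h (m * N ^ k + i))"
      using sum.shift_bounds_nat_ivl[of h 0 "m * N ^ k" "N ^ k"]
      by (simp add: atLeast0LessThan add.commute)
  qed
  also have "\<dots> = (\<Sum>i<N ^ k. \<Sum>m<N. h (m * N ^ k + i))"
    by (rule sum.swap)
  finally show ?thesis .
qed

locale uniform_bilinear_interpolant = bilinear_ifs +
  fixes f :: "real \<Rightarrow> real"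
  assumes interpolant: "is_interpolant f"
    and uniform: "\<And>j. j \<le> N \<Longrightarrow> X j = real j / real N"
    and scaling_ends: "scaling 0 = scaling N"
begin

definition gamma :: real where
  "gamma = (\<Sum>n = 1..N. (scaling (n - 1) + scaling n) / 2)"

definition S :: "nat \<Rightarrow> real \<Rightarrow> real" where
  "S m x = scaling m + (scaling (Suc m) - scaling m) * x"

lemma continuous_f: "continuous_on {0..1} f"
  using interpolant by (simp add: is_interpolant_def)

lemma f_ends: "f 0 = 0" "f 1 = 0"
proof -
  have "f (X 0) = Ylo 0" "f (X N) = Ylo N"
    using interpolant unfolding is_interpolant_def by blast+
  then show "f 0 = 0" "f 1 = 0"
    by (simp_all add: X_0 X_N Ylo_0 Ylo_N)
qed

lemma f_bound:
  obtains M where "M \<ge> 0" "\<And>x. x \<in> {0..1} \<Longrightarrow> \<bar>f x\<bar> \<le> M"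
proof -
  have "bounded (f ` {0..1})"
    by (intro compact_imp_bounded compact_continuous_image continuous_f) auto
  then obtain M where M: "\<And>x. x \<in> {0..1} \<Longrightarrow> \<bar>f x\<bar> \<le> M"
    unfolding bounded_iff by (metis image_eqI real_norm_def)
  moreover from this[of 0] have "M \<ge> 0"
    using f_ends by simp
  ultimately show ?thesis
    using that by blast
qed

lemma l_uniform:
  assumes "m < N"
  shows "l (Suc m) x = (real m + x) / real N"
  using assms uniform[of m] uniform[of "Suc m"] by (simp add: l_def field_simps)

lemma f_rec:
  assumes "m < N" "x \<in> {0..1}"
  shows "f ((real m + x) / real N) = (Ylo (Suc m) - Ylo m) * x + S m x * f x + Ylo m"
proof -
  have "Suc m \<in> {1..N}"
    using assms(1) by simp
  then have "f (l (Suc m) x) = B (Suc m) x (f x)"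
    using interpolant assms(2) unfolding is_interpolant_def by blast
  then show ?thesis
    using assms(1) by (simp add: l_uniform B_def S_def)
qed

lemma scaling_bounds: "j \<le> N \<Longrightarrow> 0 \<le> scaling j" "j \<le> N \<Longrightarrow> scaling j < 1"
  using Ylo_nonneg[of j] Ylo_le_Yhi[of j] Yhi_less_1[of j] by (auto simp: scaling_def)

lemma S_convex: "S m x = (1 - x) * scaling m + x * scaling (Suc m)"
  by (simp add: S_def algebra_simps)

lemma S_nonneg: "m < N \<Longrightarrow> x \<in> {0..1} \<Longrightarrow> 0 \<le> S m x"
  unfolding S_convex using scaling_bounds(1)[of m] scaling_bounds(1)[of "Suc m"] by simp

lemma S_contraction:
  obtains q where "0 \<le> q" "q < 1" "\<And>m x. m < N \<Longrightarrow> x \<in> {0..1} \<Longrightarrow> S m x \<le> q"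
proof
  let ?q = "Max (scaling ` {..N})"
  have q: "scaling j \<le> ?q" if "j \<le> N" for j
    using that by (intro Max_ge) auto
  show "0 \<le> ?q"
    using q[of 0] scaling_bounds(1)[of 0] by linarith
  show "?q < 1"
    using scaling_bounds by (subst Max_less_iff) auto
  show "S m x \<le> ?q" if "m < N" "x \<in> {0..1}" for m x
    unfolding S_convex using that q[of m] q[of "Suc m"]
    by (intro convex_bound_le) auto
qed

text \<open>
  The key identity. Equal end values make the slopes of the \<open>S m\<close> telescope to zero, so the
  sum does not depend on \<open>x\<close>.
\<close>

lemma sum_S: "(\<Sum>m<N. S m x) = gamma"
proof -
  have tele: "(\<Sum>m<N. scaling (Suc m) - scaling m) = 0"
    using scaling_ends by (simp add: sum_lessThan_telescope)
  have "gamma = (\<Sum>m<N. (scaling m + scaling (Suc m)) / 2)"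
    unfolding gamma_def by (simp add: sum.atLeast1_atMost_eq)
  also have "\<dots> = (\<Sum>m<N. scaling m + (scaling (Suc m) - scaling m) / 2)"
    by (intro sum.cong) (auto simp: field_simps)
  also have "\<dots> = (\<Sum>m<N. scaling m)"
    using tele by (simp add: sum.distrib flip: sum_divide_distrib)
  finally show ?thesis
    using tele by (simp add: S_def sum.distrib flip: sum_distrib_right)
qed

lemma gamma_nonneg: "gamma \<ge> 0"
  unfolding sum_S[of 0, symmetric] using S_nonneg by (intro sum_nonneg) auto

lemma sum_branches:
  assumes "x \<in> {0..1}"
  shows "(\<Sum>m<N. f ((real m + x) / real N)) = (\<Sum>m<N. Ylo m) + gamma * f x"
proof -
  have "(\<Sum>m<N. Ylo (Suc m) - Ylo m) = 0"
    using Ylo_0 Ylo_N by (simp add: sum_lessThan_telescope)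
  then show ?thesis
    using assms sum_S[of x]
    by (simp add: f_rec sum.distrib flip: sum_distrib_right)
qed

text \<open>
  Up to constants, the operator that sums over the branches has \<open>f\<close> as an eigenfunction, so it can be iterated
  without any error term.
\<close>

lemma sum_level_branches:
  "\<exists>c. \<forall>x\<in>{0..1}. (\<Sum>j<N ^ k. f ((real j + x) / real N ^ k)) = c + gamma ^ k * f x"
proof (induction k)
  case 0
  then show ?case by (intro exI[of _ 0]) simp
next
  case (Suc k)
  then obtain c where c: "\<And>x. x \<in> {0..1} \<Longrightarrow>
      (\<Sum>j<N ^ k. f ((real j + x) / real N ^ k)) = c + gamma ^ k * f x"
    by blast
  have "(\<Sum>j<N ^ Suc k. f ((real j + x) / real N ^ Suc k)) =
      real N ^ k * (\<Sum>m<N. Ylo m) + gamma * c + gamma ^ Suc k * f x" if x: "x \<in> {0..1}" for x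
  proof -
    have "(\<Sum>j<N ^ Suc k. f ((real j + x) / real N ^ Suc k)) =
        (\<Sum>i<N ^ k. \<Sum>m<N. f ((real m + (real i + x) / real N ^ k) / real N))"
      unfolding sum_digit_split using N_gt_1
      by (intro sum.cong refl arg_cong[of _ _ f]) (simp add: field_simps)
    also have "\<dots> = (\<Sum>i<N ^ k. (\<Sum>m<N. Ylo m) + gamma * f ((real i + x) / real N ^ k))"
    proof (intro sum.cong refl sum_branches)
      fix i assume "i \<in> {..<N ^ k}"
      then have "(real i + x) / real N ^ k \<in> cell N k i" "cell N k i \<subseteq> {0..1}"
        using x N_gt_1 cell_subset_unit[of N i k] by (auto simp: cell_def divide_right_mono)
      then show "(real i + x) / real N ^ k \<in> {0..1}" by blast
    qed
    also have "\<dots> = real N ^ k * (\<Sum>m<N. Ylo m) + gamma * (\<Sum>i<N ^ k. f ((real i + x) / real N ^ k))"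
      by (simp add: sum.distrib sum_distrib_left)
    finally show ?thesis
      unfolding c[OF x] by (simp add: algebra_simps)
  qed
  then show ?case by blast
qed

text \<open>
  The constant of the preceding lemma is removed by subtracting its instance at \<open>0\<close>, where \<open>f\<close>
  vanishes.
\<close>

lemma total_oscillation_ge:
  assumes "x \<in> {0..1}"
  shows "gamma ^ k * \<bar>f x\<bar> \<le>
    (\<Sum>j<N ^ k. \<bar>f ((real j + x) / real N ^ k) - f (real j / real N ^ k)\<bar>)"
proof -
  obtain c where c: "\<And>x. x \<in> {0..1} \<Longrightarrow>
      (\<Sum>j<N ^ k. f ((real j + x) / real N ^ k)) = c + gamma ^ k * f x"
    using sum_level_branches by blast
  have "gamma ^ k * f x =
      (\<Sum>j<N ^ k. f ((real j + x) / real N ^ k)) - (\<Sum>j<N ^ k. f ((real j + 0) / real N ^ k))"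
    using assms by (subst (1 2) c) (auto simp: f_ends)
  also have "\<dots> = (\<Sum>j<N ^ k. f ((real j + x) / real N ^ k) - f (real j / real N ^ k))"
    by (simp add: sum_subtractf)
  finally have "\<bar>gamma ^ k * f x\<bar> \<le>
      (\<Sum>j<N ^ k. \<bar>f ((real j + x) / real N ^ k) - f (real j / real N ^ k)\<bar>)"
    by (simp add: sum_abs)
  then show ?thesis
    using gamma_nonneg by (simp add: abs_mult)
qed

text \<open>
  The numbers \<open>\<omega> j\<close> are upper bounds for the oscillations on the cells. They are built along with
  the level: if \<open>p\<close> and \<open>r\<close> lie in cell \<open>i\<close>, the difference of the values of \<open>f\<close> at the
  \<open>m\<close>-th images of \<open>p\<close> and \<open>r\<close> is
  \<open>a\<^sub>m (p - r) + S\<^sub>m(p) (f p - f r) + (s\<^sub>m\<^sub>+\<^sub>1 - s\<^sub>m) (p - r) f r\<close>. Only the middle term is multiplied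
  by the old oscillation; the others are at most a multiple of the cell length, and add up to a
  constant over all cells of a level.
\<close>

lemma total_oscillation_le:
  obtains D where "D \<ge> 0"
    "\<And>k. \<exists>\<omega>. (\<forall>j<N ^ k. \<forall>u\<in>cell N k j. \<forall>v\<in>cell N k j. \<bar>f u - f v\<bar> \<le> \<omega> j) \<and>
      (\<Sum>j<N ^ k. \<omega> j) \<le> D * (real k + 1) * max 1 gamma ^ k"
proof -
  obtain M where M: "M \<ge> 0" "\<And>x. x \<in> {0..1} \<Longrightarrow> \<bar>f x\<bar> \<le> M"
    using f_bound by blast
  define g where "g = max 1 gamma"
  define a where "a m = \<bar>Ylo (Suc m) - Ylo m\<bar>" for m
  define d where "d m = \<bar>scaling (Suc m) - scaling m\<bar>" for m
  define A where "A = (\<Sum>m<N. a m + d m * M)"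
  define d' where "d' = (\<Sum>m<N. d m)"
  have nonneg: "A \<ge> 0" "d' \<ge> 0" "g \<ge> 1"
    using M(1) by (auto simp: A_def d'_def a_def d_def g_def intro!: sum_nonneg add_nonneg_nonneg)
  \<comment> \<open>Dominates the product of the perturbation factors \<open>1 + d' N\<^sup>-\<^sup>i\<close>, and stays bounded.\<close>
  define e where "e k = exp (\<Sum>i<k. d' / real N ^ i)" for k
  have step: "\<exists>\<omega>. (\<forall>j<N ^ k. \<forall>u\<in>cell N k j. \<forall>v\<in>cell N k j. \<bar>f u - f v\<bar> \<le> \<omega> j) \<and>
      (\<Sum>j<N ^ k. \<omega> j) \<le> (2 * M + real k * A) * g ^ k * e k" for k
  proof (induction k)
    case 0
    have "\<bar>f u - f v\<bar> \<le> 2 * M" if "u \<in> cell N 0 0" "v \<in> cell N 0 0" for u v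
      using M(2)[of u] M(2)[of v] that by (simp add: cell_def)
    then show ?case
      by (intro exI[of _ "\<lambda>_. 2 * M"]) (auto simp: e_def)
  next
    case (Suc k)
    then obtain \<omega> where \<omega>: "\<And>j u v. j < N ^ k \<Longrightarrow> u \<in> cell N k j \<Longrightarrow> v \<in> cell N k j \<Longrightarrow> \<bar>f u - f v\<bar> \<le> \<omega> j"
        "(\<Sum>j<N ^ k. \<omega> j) \<le> (2 * M + real k * A) * g ^ k * e k"
      by blast
    define \<delta> where "\<delta> = 1 / real N ^ k"
    \<comment> \<open>Evaluating \<open>S m\<close> at the left end of the cell \<open>i\<close> lets the sum over \<open>m\<close> collapse to \<open>gamma\<close>.\<close>
    define \<omega>' where "\<omega>' j = (let m = j div N ^ k; i = j mod N ^ k in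
      (a m + d m * M) * \<delta> + (S m (real i * \<delta>) + d m * \<delta>) * \<omega> i)" for j
    have \<delta>: "\<delta> > 0" "real N ^ k * \<delta> = 1"
      using N_gt_1 by (auto simp: \<delta>_def)
    have Npos: "N ^ k > 0"
      using N_gt_1 by simp
    have "\<bar>f u - f v\<bar> \<le> \<omega>' j"
      if j: "j < N ^ Suc k" and u: "u \<in> cell N (Suc k) j" and v: "v \<in> cell N (Suc k) j" for j u v
    proof -
      define m i where "m = j div N ^ k" and "i = j mod N ^ k"
      have m: "m < N" and i: "i < N ^ k" and jmi: "j = m * N ^ k + i"
        using j Npos by (simp_all only: m_def i_def div_mult_mod_eq) (simp_all add: less_mult_imp_div_less)
      define x where "x w = real N * w - real m" for w
      have x: "x w \<in> cell N k i" "w = (real m + x w) / real N" if "w \<in> cell N (Suc k) j" for w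
      proof -
        show "w = (real m + x w) / real N"
          using N_gt_1 by (simp add: x_def)
        have "real j \<le> real N ^ k * (real N * w)" "real N ^ k * (real N * w) \<le> real j + 1"
          using that N_gt_1 by (auto simp: cell_def field_simps)
        then have "real i \<le> real N ^ k * x w" "real N ^ k * x w \<le> real i + 1"
          unfolding jmi x_def by (simp_all add: algebra_simps)
        then show "x w \<in> cell N k i"
          using N_gt_1 by (simp add: cell_def field_simps)
      qed
      define p r where "p = x u" and "r = x v"
      have pr: "p \<in> cell N k i" "r \<in> cell N k i"
        using x(1) u v by (auto simp: p_def r_def)
      then have pr01: "p \<in> {0..1}" "r \<in> {0..1}"
        using cell_subset_unit[of N i k] i N_gt_1 by auto
      have dist: "\<bar>p - r\<bar> \<le> \<delta>" "real i * \<delta> \<le> p" "p \<le> real i * \<delta> + \<delta>"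
        using pr by (auto simp: cell_def \<delta>_def add_divide_distrib)
      have "f u - f v = f ((real m + p) / real N) - f ((real m + r) / real N)"
        using x(2)[OF u] x(2)[OF v] by (simp add: p_def r_def)
      also have "\<dots> = (Ylo (Suc m) - Ylo m) * (p - r) + S m p * (f p - f r) +
          (scaling (Suc m) - scaling m) * (p - r) * f r"
        unfolding f_rec[OF m pr01(1)] f_rec[OF m pr01(2)] by (simp add: S_def algebra_simps)
      also have "\<bar>\<dots>\<bar> \<le> \<bar>(Ylo (Suc m) - Ylo m) * (p - r)\<bar> + \<bar>S m p * (f p - f r)\<bar> +
          \<bar>(scaling (Suc m) - scaling m) * (p - r) * f r\<bar>"
        by linarith
      also have "\<dots> = a m * \<bar>p - r\<bar> + S m p * \<bar>f p - f r\<bar> + d m * \<bar>p - r\<bar> * \<bar>f r\<bar>"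
        using S_nonneg[OF m pr01(1)] by (simp add: a_def d_def abs_mult)
      also have "\<dots> \<le> a m * \<delta> + (S m (real i * \<delta>) + d m * \<delta>) * \<omega> i + d m * \<delta> * M"
      proof (intro add_mono mult_mono)
        show "S m p \<le> S m (real i * \<delta>) + d m * \<delta>"
        proof -
          have "S m p - S m (real i * \<delta>) = (scaling (Suc m) - scaling m) * (p - real i * \<delta>)"
            by (simp add: S_def algebra_simps)
          also have "\<dots> \<le> d m * \<delta>"
            unfolding d_def using dist by (intro mult_mono) auto
          finally show ?thesis by linarith
        qed
        then show "0 \<le> S m (real i * \<delta>) + d m * \<delta>"
          using S_nonneg[OF m pr01(1)] by linarith
        show "\<bar>f p - f r\<bar> \<le> \<omega> i"
          using \<omega>(1)[OF i pr] .
      qed (use dist M(2)[OF pr01(2)] \<delta> in \<open>auto simp: a_def d_def\<close>)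
      also have "\<dots> = \<omega>' j"
        by (simp add: \<omega>'_def Let_def m_def i_def algebra_simps)
      finally show ?thesis .
    qed
    moreover have "(\<Sum>j<N ^ Suc k. \<omega>' j) \<le> (2 * M + real (Suc k) * A) * g ^ Suc k * e (Suc k)"
    proof -
      have "(\<Sum>j<N ^ Suc k. \<omega>' j) =
          (\<Sum>i<N ^ k. \<Sum>m<N. (a m + d m * M) * \<delta> + (S m (real i * \<delta>) + d m * \<delta>) * \<omega> i)"
        unfolding sum_digit_split using Npos
        by (intro sum.cong refl) (simp add: \<omega>'_def Let_def)
      also have "\<dots> = (\<Sum>i<N ^ k. A * \<delta> + (gamma + d' * \<delta>) * \<omega> i)"
        by (simp add: sum.distrib sum_S A_def d'_def flip: sum_distrib_right)
      also have "\<dots> = A + (gamma + d' * \<delta>) * (\<Sum>i<N ^ k. \<omega> i)"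
        using \<delta>(2) by (simp add: sum.distrib sum_distrib_left mult.left_commute)
      also have "\<dots> \<le> A + g * exp (d' * \<delta>) * ((2 * M + real k * A) * g ^ k * e k)"
      proof (intro add_left_mono mult_mono)
        have "gamma + d' * \<delta> \<le> g * (1 + d' * \<delta>)"
        proof -
          have "1 * (d' * \<delta>) \<le> g * (d' * \<delta>)"
            using nonneg \<delta> by (intro mult_right_mono) auto
          then show ?thesis
            by (simp add: algebra_simps g_def)
        qed
        also have "\<dots> \<le> g * exp (d' * \<delta>)"
          using nonneg by (intro mult_left_mono exp_ge_add_one_self) auto
        finally show "gamma + d' * \<delta> \<le> g * exp (d' * \<delta>)" .
        have "\<omega> i \<ge> 0" if "i < N ^ k" for i
        proof -
          have "real i / real N ^ k \<in> cell N k i"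
            by (simp add: cell_def divide_right_mono)
          from \<omega>(1)[OF that this this] show ?thesis by simp
        qed
        then show "0 \<le> (\<Sum>i<N ^ k. \<omega> i)"
          by (intro sum_nonneg) auto
      qed (use \<omega>(2) nonneg in auto)
      also have "\<dots> = A + (2 * M + real k * A) * g ^ Suc k * e (Suc k)"
        by (simp add: e_def exp_add \<delta>_def algebra_simps)
      also have "\<dots> \<le> A * (g ^ Suc k * e (Suc k)) + (2 * M + real k * A) * g ^ Suc k * e (Suc k)"
      proof -
        have "1 \<le> g ^ Suc k" "1 \<le> e (Suc k)"
          using nonneg by (auto simp: e_def simp del: power_Suc sum.lessThan_Suc intro!: sum_nonneg)
        then have "1 * 1 \<le> g ^ Suc k * e (Suc k)"
          by (intro mult_mono) auto
        then show ?thesis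
          using nonneg mult_left_mono[of 1 "g ^ Suc k * e (Suc k)" A] by simp
      qed
      finally show ?thesis
        by (simp add: algebra_simps)
    qed
    ultimately show ?case by blast
  qed
  define D where "D = (2 * M + A) * exp (2 * d')"
  have "D \<ge> 0"
    using M nonneg by (simp add: D_def)
  moreover have "(2 * M + real k * A) * g ^ k * e k \<le> D * (real k + 1) * g ^ k" for k
  proof -
    have "(\<Sum>i<k. d' / real N ^ i) = d' * (\<Sum>i<k. (1 / real N) ^ i)"
      by (simp add: sum_distrib_left power_one_over)
    also have "\<dots> \<le> d' * 2"
    proof (intro mult_left_mono nonneg)
      have "(\<Sum>i<k. (1 / real N) ^ i) \<le> (\<Sum>i<k. (1 / 2) ^ i)"
        using N_gt_1 by (intro sum_mono power_mono) (auto simp: field_simps)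
      also have "\<dots> \<le> 2"
        by (simp add: sum_gp_strict)
      finally show "(\<Sum>i<k. (1 / real N) ^ i) \<le> 2" .
    qed
    finally have e: "e k \<le> exp (2 * d')"
      by (simp add: e_def mult.commute)
    have "2 * M + real k * A \<le> (2 * M + A) * (real k + 1)"
      using M nonneg by (simp add: algebra_simps)
    then have "(2 * M + real k * A) * g ^ k * e k \<le> (2 * M + A) * (real k + 1) * g ^ k * exp (2 * d')"
      using e M nonneg by (intro mult_mono) (auto simp: e_def)
    then show ?thesis
      by (simp add: D_def algebra_simps)
  qed
  ultimately show ?thesis
    using that[of D] step unfolding g_def by (meson order_trans)
qed

section \<open>The attractor\<close>

text \<open>
  The branch \<open>w (Suc m)\<close> multiplies the vertical gap \<open>y - f(x)\<close> by \<open>S m x \<le> q < 1\<close>. Every point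
  of the attractor has preimages in it of all orders, so its gap is at most \<open>q\<^sup>k\<close> times a
  constant for every \<open>k\<close>.
\<close>

lemma attractor_subset_graph:
  assumes "is_attractor A"
  shows "A \<subseteq> unit_graph f"
proof -
  obtain M where M: "\<And>x. x \<in> {0..1} \<Longrightarrow> \<bar>f x\<bar> \<le> M"
    using f_bound by blast
  obtain q where q: "0 \<le> q" "q < 1" "\<And>m x. m < N \<Longrightarrow> x \<in> {0..1} \<Longrightarrow> S m x \<le> q"
    using S_contraction by blast
  have A: "A \<subseteq> {0..1} \<times> {0..1}" "A = (\<Union>n\<in>{1..N}. w n ` A)"
    using assms by (auto simp: is_attractor_def)
  have gap: "\<bar>y - f x\<bar> \<le> q ^ k * (1 + M)" if "(x, y) \<in> A" for x y k
    using that
  proof (induction k arbitrary: x y)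
    case 0
    then have "x \<in> {0..1}" "y \<in> {0..1}"
      using A(1) by auto
    then show ?case
      using M[of x] by auto
  next
    case (Suc k)
    obtain n x' y' where n: "n \<in> {1..N}" "(x', y') \<in> A" "(x, y) = w n (x', y')"
      using subsetD[OF equalityD1[OF A(2)] Suc.prems] by (auto 0 0)
    obtain m where m: "n = Suc m" "m < N"
      using n(1) by (cases n) auto
    have x': "x' \<in> {0..1}"
      using n(2) A(1) by auto
    have "x = (real m + x') / real N"
      using n(3) m by (simp add: w_def l_uniform)
    moreover have "y = (Ylo (Suc m) - Ylo m) * x' + S m x' * y' + Ylo m"
      using n(3) m by (simp add: w_def B_def S_def)
    ultimately have "y - f x = S m x' * (y' - f x')"
      using f_rec[OF m(2) x'] by (simp add: algebra_simps)
    then have "\<bar>y - f x\<bar> = S m x' * \<bar>y' - f x'\<bar>"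
      using S_nonneg[OF m(2) x'] by (simp add: abs_mult)
    also have "\<dots> \<le> q * (q ^ k * (1 + M))"
      using q(1) q(3)[OF m(2) x'] Suc.IH[OF n(2)] by (intro mult_mono) auto
    finally show ?case by simp
  qed
  show ?thesis
  proof clarify
    fix x y assume xy: "(x, y) \<in> A"
    have "(\<lambda>k. q ^ k * (1 + M)) \<longlonglongrightarrow> 0 * (1 + M)"
      using q by (intro tendsto_mult LIMSEQ_realpow_zero tendsto_const)
    then have "\<bar>y - f x\<bar> \<le> 0 * (1 + M)"
      using gap[OF xy] by (intro LIMSEQ_le_const) auto
    then have "y = f x" by simp
    then show "(x, y) \<in> unit_graph f"
      using xy A(1) by (auto simp: unit_graph_def)
  qed
qed

text \<open>
  Expanding \<open>x\<close> by \<open>k\<close> digits, moving to any point of the projection and contracting back along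
  the same digits gives a point of the projection within \<open>N\<^sup>-\<^sup>k\<close> of \<open>x\<close>. The projection is
  therefore dense in the unit interval, and it is closed.
\<close>

lemma attractor_projection:
  assumes "is_attractor A"
  shows "fst ` A = {0..1}"
proof
  have A: "A \<noteq> {}" "compact A" "A \<subseteq> {0..1} \<times> {0..1}" "A = (\<Union>n\<in>{1..N}. w n ` A)"
    using assms by (auto simp: is_attractor_def)
  show sub: "fst ` A \<subseteq> {0..1}"
    using A(3) by auto
  have inv: "(real m + z) / real N \<in> fst ` A" if m: "m < N" and z: "z \<in> fst ` A" for m z
  proof -
    obtain y where "(z, y) \<in> A"
      using z by auto
    then have "w (Suc m) (z, y) \<in> A"
      using m by (subst A(4)) auto
    then show ?thesis
      using m by (force simp: w_def l_uniform intro: image_eqI[of _ fst])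
  qed
  have near: "\<exists>z\<in>fst ` A. \<bar>x - z\<bar> \<le> (1 / real N) ^ k" if "x \<in> {0..1}" for x k
    using that
  proof (induction k arbitrary: x)
    case 0
    obtain z where "z \<in> fst ` A"
      using A(1) by blast
    moreover from this have "z \<in> {0..1}"
      using sub by blast
    ultimately show ?case
      using 0 by (intro bexI[of _ z]) auto
  next
    case (Suc k)
    obtain m where m: "m < N" "x \<in> cell N 1 m"
      using in_some_cell[of N x 1] Suc.prems N_gt_1 by auto
    define x' where "x' = real N * x - real m"
    have x': "x' \<in> {0..1}" "x = (real m + x') / real N"
      using m N_gt_1 by (auto simp: x'_def cell_def field_simps)
    obtain z where z: "z \<in> fst ` A" "\<bar>x' - z\<bar> \<le> (1 / real N) ^ k"
      using Suc.IH[OF x'(1)] by blast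
    have "x - (real m + z) / real N = (x' - z) / real N"
      by (simp add: x'(2) diff_divide_distrib add_divide_distrib)
    then have "\<bar>x - (real m + z) / real N\<bar> \<le> (1 / real N) ^ Suc k"
      using z(2) N_gt_1 by (simp add: abs_divide divide_right_mono)
    then show ?case
      using inv[OF m(1) z(1)] by blast
  qed
  have closed: "closed (fst ` A)"
    by (intro compact_imp_closed compact_continuous_image A(2) continuous_intros)
  show "{0..1} \<subseteq> fst ` A"
  proof
    fix x :: real assume x: "x \<in> {0..1}"
    have "x \<in> closure (fst ` A)"
      unfolding closure_approachable
    proof (intro allI impI)
      fix r :: real assume "r > 0"
      moreover have "(\<lambda>k. (1 / real N) ^ k) \<longlonglongrightarrow> 0"
        using N_gt_1 by (intro LIMSEQ_realpow_zero) auto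
      ultimately obtain k where "(1 / real N) ^ k < r"
        using eventually_happens[OF order_tendstoD(2)] by (metis sequentially_bot)
      then show "\<exists>y\<in>fst ` A. dist y x < r"
        using near[OF x, of k] by (force simp: dist_real_def abs_minus_commute)
    qed
    then show "x \<in> fst ` A"
      using closed by simp
  qed
qed

lemma attractor_eq_graph:
  assumes "is_attractor A"
  shows "A = unit_graph f"
proof
  show "A \<subseteq> unit_graph f"
    using attractor_subset_graph[OF assms] .
  show "unit_graph f \<subseteq> A"
  proof
    fix p assume "p \<in> unit_graph f"
    then obtain x where x: "x \<in> {0..1}" "p = (x, f x)"
      by (auto simp: unit_graph_def)
    then obtain y where y: "(x, y) \<in> A"
      using attractor_projection[OF assms] by force
    then have "y = f x"
      using attractor_subset_graph[OF assms] by (auto simp: unit_graph_def)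
    then show "p \<in> A"
      using x y by simp
  qed
qed

section \<open>The dimension formula\<close>

text \<open>A segment is convex, and the graph contains \<open>(0, 0)\<close> and \<open>(1, 0)\<close>.\<close>

lemma line_segment_iff: "is_line_segment (unit_graph f) \<longleftrightarrow> (\<forall>x\<in>{0..1}. f x = 0)"
proof
  assume "is_line_segment (unit_graph f)"
  then have conv: "convex (unit_graph f)"
    by (auto simp: is_line_segment_def)
  have ends: "(0, 0) \<in> unit_graph f" "(1, 0) \<in> unit_graph f"
    using f_ends by (auto simp: unit_graph_def image_iff intro: bexI[of _ 0] bexI[of _ 1])
  show "\<forall>x\<in>{0..1}. f x = 0"
  proof
    fix x :: real assume "x \<in> {0..1}"
    then have "(1 - x) *\<^sub>R (0, 0) + x *\<^sub>R (1, 0) \<in> unit_graph f"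
      by (intro convexD[OF conv ends]) auto
    then show "f x = 0"
      by (auto simp: unit_graph_def)
  qed
next
  assume "\<forall>x\<in>{0..1}. f x = 0"
  then have "unit_graph f = (\<lambda>x. (x, 0)) ` {0..1}"
    by (auto simp: unit_graph_def)
  also have "\<dots> = closed_segment (0, 0) (1, 0)"
    by (force simp: closed_segment_def image_iff)
  finally show "is_line_segment (unit_graph f)"
    unfolding is_line_segment_def by (intro exI[of _ "(0, 0)"] exI[of _ "(1, 0)"]) auto
qed

lemma box_dimension_graph:
  "if gamma > 1 \<and> \<not> is_line_segment (unit_graph f)
   then has_box_dimension (unit_graph f) (1 + ln gamma / ln (real N))
   else has_box_dimension (unit_graph f) 1"
proof -
  obtain D where D: "D \<ge> 0"
    "\<And>k. \<exists>\<omega>. (\<forall>j<N ^ k. \<forall>u\<in>cell N k j. \<forall>v\<in>cell N k j. \<bar>f u - f v\<bar> \<le> \<omega> j) \<and>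
      (\<Sum>j<N ^ k. \<omega> j) \<le> D * (real k + 1) * max 1 gamma ^ k"
    using total_oscillation_le by blast
  consider "gamma \<le> 1" | "is_line_segment (unit_graph f)"
    | "gamma > 1" "\<not> is_line_segment (unit_graph f)"
    by linarith
  then show ?thesis
  proof cases
    case 1
    then have "has_box_dimension (unit_graph f) (1 + ln 1 / ln (real N))"
      using D by (intro box_dimension_of_oscillation[of N 1 1 D] N_gt_1 continuous_f) (auto simp: max_absorb1)
    then show ?thesis
      using 1 by simp
  next
    case 2
    then have zero: "f x = 0" if "x \<in> cell N k j" "j < N ^ k" for x k j
      using that cell_subset_unit[of N j k] N_gt_1 by (auto simp: line_segment_iff)
    \<comment> \<open>All oscillations vanish, so the growth rate to use is 1, however large \<open>gamma\<close> is.\<close>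
    have "has_box_dimension (unit_graph f) (1 + ln 1 / ln (real N))"
      by (intro box_dimension_of_oscillation[of N 1 1 0] N_gt_1 continuous_f exI[of _ "\<lambda>_. 0"])
        (auto simp: zero)
    then show ?thesis
      using 2 by simp
  next
    case 3
    then obtain x where x: "x \<in> {0..1}" "f x \<noteq> 0"
      by (auto simp: line_segment_iff)
    have cells: "(real j + x) / real N ^ k \<in> cell N k j \<and> real j / real N ^ k \<in> cell N k j" for j k
      using x(1) by (auto simp: cell_def divide_right_mono)
    have "has_box_dimension (unit_graph f) (1 + ln gamma / ln (real N))"
    proof (rule box_dimension_of_oscillation[of N gamma "\<bar>f x\<bar>" D])
      have "\<exists>u v. (\<forall>j<N ^ k. u j \<in> cell N k j \<and> v j \<in> cell N k j) \<and>
          \<bar>f x\<bar> * gamma ^ k \<le> (\<Sum>j<N ^ k. \<bar>f (u j) - f (v j)\<bar>)" for k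
        using cells total_oscillation_ge[OF x(1), of k]
        by (intro exI[of _ "\<lambda>j. (real j + x) / real N ^ k"] exI[of _ "\<lambda>j. real j / real N ^ k"])
          (simp add: mult.commute)
      then show "gamma = 1 \<or> (\<forall>k. \<exists>u v. (\<forall>j<N ^ k. u j \<in> cell N k j \<and> v j \<in> cell N k j) \<and>
          \<bar>f x\<bar> * gamma ^ k \<le> (\<Sum>j<N ^ k. \<bar>f (u j) - f (v j)\<bar>))"
        by blast
      show "\<exists>\<omega>. (\<forall>j<N ^ k. \<forall>u\<in>cell N k j. \<forall>v\<in>cell N k j. \<bar>f u - f v\<bar> \<le> \<omega> j) \<and>
          (\<Sum>j<N ^ k. \<omega> j) \<le> D * (real k + 1) * gamma ^ k" for k
        using D(2)[of k] 3(1) by (simp add: max_def)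
    qed (use N_gt_1 continuous_f D(1) x(2) 3(1) in auto)
    then show ?thesis
      using 3 by simp
  qed
qed

end

theorem theorem6:
  fixes N :: nat
    and X Ylo Yhi s :: "nat \<Rightarrow> real"
    and A :: "(real \<times> real) set"
    and f :: "real \<Rightarrow> real"
    and \<gamma> :: real
  defines "s \<equiv> bilinear_ifs.scaling Ylo Yhi"
    and "\<gamma> \<equiv> \<Sum>n = 1..N. (s (n - 1) + s n) / 2"
  assumes "bilinear_ifs N X Ylo Yhi"
    and "bilinear_ifs.is_attractor N X Ylo Yhi A"
    and "bilinear_ifs.is_interpolant N X Ylo Yhi f"
    and "\<And>j. j \<le> N \<Longrightarrow> X j = real j / real N"
    and "s 0 = s N"
  shows "A = unit_graph f \<and>
    (if \<gamma> > 1 \<and> \<not> is_line_segment (unit_graph f)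
     then has_box_dimension (unit_graph f) (1 + ln \<gamma> / ln (real N))
     else has_box_dimension (unit_graph f) 1)"
proof -
  interpret uniform_bilinear_interpolant N X Ylo Yhi f
    using assms by (intro uniform_bilinear_interpolant.intro uniform_bilinear_interpolant_axioms.intro) auto
  have "\<gamma> = gamma"
    by (simp add: \<gamma>_def gamma_def s_def)
  then show ?thesis
    using attractor_eq_graph[OF assms(4)] box_dimension_graph by blast
qed

end
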